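(* Let $d\ge1$, let $\{\mathbf{Y}_n\}_{n\ge 0}$ be an $\mathcal{S}_d^{+}$-valued supermartingale with respect to a filtration $\{\mathcal{F}_n\}_{n\ge 0}$, and let $\tau$ be a stopping time on $\{\mathcal{F}_n\}$. Let $U$ be a super-uniform random scalar independent of $\mathcal{F}_\infty$. Then for any deterministic $\mathbf{A}\in\mathcal{S}_d^{++}$, $$\mathbb{P}(\mathbf{Y}_\tau\not\preceq U\mathbf{A})\le\mathrm{tr}\big((\mathbb{E}\,\mathbf{Y}_0)\mathbf{A}^{-1}\big),$$ and $$\mathbb{P}\big(\exists n<\tau,\ \mathbf{Y}_n\not\preceq\mathbf{A}\ \text{ or }\ \mathbf{Y}_\tau\not\preceq U\mathbf{A}\big)\le\mathrm{tr}\big((\mathbb{E}\,\mathbf{Y}_0)\mathbf{A}^{-1}\big).$$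
   Context: $\mathcal{S}_d$ is the set of real symmetric $d\times d$ matrices, $\mathcal{S}_d^{+}$ the subset of positive semidefinite ones, $\mathcal{S}_d^{++}$ the subset of positive definite ones. $\preceq$ is the Loewner order: $\mathbf{A}\preceq\mathbf{B}$ iff $\mathbf{B}-\mathbf{A}$ is positive semidefinite; $\mathbf{A}\not\preceq\mathbf{B}$ is its negation. Expectations and conditional expectations of random matrices are entrywise. An $\mathcal{S}_d$-valued (integrable) process $\{\mathbf{Y}_n\}_{n\ge 0}$ adapted to $\{\mathcal{F}_n\}_{n\ge 0}$ is a supermartingale if $\mathbb{E}(\mathbf{Y}_n\mid\mathcal{F}_{n-1})\preceq\mathbf{Y}_{n-1}$ almost surely for all $n\ge 1$. Every $\mathcal{S}_d^+$-valued supermartingale converges almost surely; on $\{\tau=\infty\}$, $\mathbf{Y}_\tau$ denotes the almost sure limit $\mathbf{Y}_\infty$. $\mathcal{F}_\infty$ is the $\sigma$-algebra generated by $\bigcup_n\mathcal{F}_n$. A random scalar $U$ is super-uniform if $\mathbb{P}(U\le x)\le x$ for all $x\ge0$. *)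

theory Defs
  imports "HOL-Probability.Probability"
begin

section \<open>Symmetric matrices and the Loewner order\<close>

definition symmetric_matrix :: "real ^ 'd ^ 'd \<Rightarrow> bool" where
  "symmetric_matrix X \<longleftrightarrow> transpose X = X"

definition pos_semidef :: "real ^ 'd ^ 'd \<Rightarrow> bool" where
  "pos_semidef X \<longleftrightarrow> symmetric_matrix X \<and> (\<forall>v. 0 \<le> v \<bullet> (X *v v))"

definition pos_def :: "real ^ 'd ^ 'd \<Rightarrow> bool" where
  "pos_def X \<longleftrightarrow> symmetric_matrix X \<and> (\<forall>v. v \<noteq> 0 \<longrightarrow> 0 < v \<bullet> (X *v v))"

definition loewner_le :: "real ^ 'd ^ 'd \<Rightarrow> real ^ 'd ^ 'd \<Rightarrow> bool" (infix "\<preceq>" 50) where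
  "X \<preceq> Z \<longleftrightarrow> pos_semidef (Z - X)"

section \<open>Random matrices\<close>

definition matrix_integrable :: "'a measure \<Rightarrow> ('a \<Rightarrow> real ^ 'd ^ 'd) \<Rightarrow> bool" where
  "matrix_integrable M X \<longleftrightarrow> (\<forall>i j. integrable M (\<lambda>\<omega>. X \<omega> $ i $ j))"

definition matrix_expectation :: "'a measure \<Rightarrow> ('a \<Rightarrow> real ^ 'd ^ 'd) \<Rightarrow> real ^ 'd ^ 'd" where
  "matrix_expectation M X = (\<chi> i j. integral\<^sup>L M (\<lambda>\<omega>. X \<omega> $ i $ j))"

definition matrix_cond_exp ::
    "'a measure \<Rightarrow> 'a measure \<Rightarrow> ('a \<Rightarrow> real ^ 'd ^ 'd) \<Rightarrow> 'a \<Rightarrow> real ^ 'd ^ 'd" where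
  "matrix_cond_exp M G X \<omega> = (\<chi> i j. real_cond_exp M G (\<lambda>\<omega>. X \<omega> $ i $ j) \<omega>)"

definition matrix_supermartingale ::
    "'a measure \<Rightarrow> (nat \<Rightarrow> 'a measure) \<Rightarrow> (nat \<Rightarrow> 'a \<Rightarrow> real ^ 'd ^ 'd) \<Rightarrow> bool" where
  "matrix_supermartingale M F Y \<longleftrightarrow>
     (\<forall>n. Y n \<in> borel_measurable (F n)) \<and>
     (\<forall>n. \<forall>\<omega>\<in>space M. symmetric_matrix (Y n \<omega>)) \<and>
     (\<forall>n. matrix_integrable M (Y n)) \<and>
     (\<forall>n\<ge>1. AE \<omega> in M. matrix_cond_exp M (F (n - 1)) (Y n) \<omega> \<preceq> Y (n - 1) \<omega>)"

section \<open>Stopping times with values in the extended natural numbers\<close>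

definition F_infinity :: "'a measure \<Rightarrow> (nat \<Rightarrow> 'a measure) \<Rightarrow> 'a measure" where
  "F_infinity M F = sigma (space M) (\<Union>n. sets (F n))"

text \<open>
  The library's \<^const>\<open>stopping_time\<close> uses one type for the index set and for the values, which
  would rule out the value \<^term>\<open>\<infinity> :: enat\<close> for a filtration indexed by \<^typ>\<open>nat\<close>. The lemma
  below relates the two.
\<close>

definition enat_stopping_time :: "(nat \<Rightarrow> 'a measure) \<Rightarrow> ('a \<Rightarrow> enat) \<Rightarrow> bool" where
  "enat_stopping_time F \<tau> \<longleftrightarrow> (\<forall>n. Measurable.pred (F n) (\<lambda>\<omega>. \<tau> \<omega> \<le> enat n))"

lemma enat_stopping_time_iff_stopping_time:
  "enat_stopping_time F \<tau> \<longleftrightarrow> stopping_time (case_enat F (F_infinity M F)) \<tau>"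
proof
  assume "enat_stopping_time F \<tau>"
  then show "stopping_time (case_enat F (F_infinity M F)) \<tau>"
    unfolding stopping_time_def enat_stopping_time_def by (auto split: enat.split)
next
  assume *: "stopping_time (case_enat F (F_infinity M F)) \<tau>"
  show "enat_stopping_time F \<tau>"
    unfolding enat_stopping_time_def using stopping_timeD[OF *, of "enat _"] by simp
qed

text \<open>
  Where \<open>\<tau> = \<infinity>\<close>, the value is the pointwise limit of the sequence; \<^const>\<open>lim\<close> is unspecified
  where the sequence diverges, which for a supermartingale with positive semidefinite values
  happens only on a null set.
\<close>

definition stopped_value ::
    "(nat \<Rightarrow> 'a \<Rightarrow> real ^ 'd ^ 'd) \<Rightarrow> ('a \<Rightarrow> enat) \<Rightarrow> 'a \<Rightarrow> real ^ 'd ^ 'd" where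
  "stopped_value Y \<tau> \<omega> = (case \<tau> \<omega> of enat n \<Rightarrow> Y n \<omega> | \<infinity> \<Rightarrow> lim (\<lambda>n. Y n \<omega>))"

section \<open>Super-uniform random variables\<close>

definition super_uniform :: "'a measure \<Rightarrow> ('a \<Rightarrow> real) \<Rightarrow> bool" where
  "super_uniform M U \<longleftrightarrow>
     U \<in> borel_measurable M \<and> (\<forall>x\<ge>0. measure M {\<omega> \<in> space M. U \<omega> \<le> x} \<le> x)"

definition indep_of_algebra :: "'a measure \<Rightarrow> ('a \<Rightarrow> real) \<Rightarrow> 'a measure \<Rightarrow> bool" where
  "indep_of_algebra M U G \<longleftrightarrow>
     prob_space.indep_set M {U -` B \<inter> space M | B. B \<in> sets borel} (sets G)"

end

theory Submission
  imports Defs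
begin

text \<open>
  Choose a basis \<open>B\<close> that is orthonormal for the form \<open>v \<bullet> A w\<close>. Then the inverse of \<open>A\<close> is the sum of the
  matrices \<open>b b\<^sup>T\<close> over \<open>b \<in> B\<close>, so \<open>X\<^sub>n = tr (Y\<^sub>n A\<^sup>-\<^sup>1)\<close> is the sum of the forms \<open>b \<bullet> Y\<^sub>n b\<close>, a scalar
  nonnegative supermartingale, and Lagrange's identity shows that \<open>tr (Y A\<^sup>-\<^sup>1) \<le> u\<close> forces \<open>Y \<preceq> u A\<close>.
  It therefore suffices to bound the probability that \<open>X\<close> exceeds 1 before \<open>\<tau>\<close> or that \<open>X\<^sub>\<tau> \<ge> U\<close>.
  Stop \<open>X\<close> at \<open>\<tau>\<close> or at its first passage above 1, and let \<open>V\<close> be the stopped value truncated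
  at 1. The event lies in \<open>U \<le> V \<or> V = 1\<close>, whose conditional probability given \<open>V\<close> is at most \<open>V\<close>,
  and \<open>E V \<le> E X\<^sub>0\<close> by Fatou's lemma. Where \<open>\<tau> = \<infinity>\<close> one needs that \<open>Y\<close> converges almost surely, which follows by
  polarization from the upcrossing argument for the scalar supermartingales \<open>v \<bullet> Y\<^sub>n v\<close>.
\<close>

section \<open>Bases orthonormal for a quadratic form\<close>

lemma symmetric_matrix_inner_commute:
  "symmetric_matrix A \<Longrightarrow> v \<bullet> (A *v w) = w \<bullet> (A *v v)"
  by (metis dot_lmul_matrix inner_commute symmetric_matrix_def transpose_matrix_vector)

definition form_orthonormal :: "real ^ 'd ^ 'd \<Rightarrow> (real ^ 'd) set \<Rightarrow> bool" where
  "form_orthonormal A B \<longleftrightarrow> (\<forall>b\<in>B. \<forall>c\<in>B. b \<bullet> (A *v c) = (if b = c then 1 else 0))"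

lemma matrix_vector_mult_sum:
  fixes A :: "real ^ 'n ^ 'm"
  shows "A *v (\<Sum>i\<in>I. f i) = (\<Sum>i\<in>I. A *v f i)"
  by (rule linear_sum) simp

text \<open>Pairing a vanishing combination with \<open>b\<close> in the form isolates the
  coefficient of \<open>b\<close>. Independence bounds the size of such families by the dimension,
  so a largest one exists.\<close>

lemma form_orthonormal_independent:
  assumes "form_orthonormal A B" "finite B"
  shows "independent B"
proof (rule real_vector.independent_if_scalars_zero)
  fix f b assume z: "(\<Sum>x\<in>B. f x *\<^sub>R x) = 0" and b: "b \<in> B"
  have "0 = b \<bullet> (A *v (\<Sum>x\<in>B. f x *\<^sub>R x))"
    by (simp add: z)
  also have "\<dots> = (\<Sum>x\<in>B. f x * (b \<bullet> (A *v x)))"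
    by (simp add: matrix_vector_mult_sum inner_sum_right matrix_vector_mult_scaleR)
  also have "\<dots> = (\<Sum>x\<in>B. if x = b then f x else 0)"
    using assms(1) b by (intro sum.cong) (auto simp: form_orthonormal_def)
  also have "\<dots> = f b"
    using assms(2) b by simp
  finally show "f b = 0" by simp
qed fact

text \<open>Gram-Schmidt by maximality: a largest orthonormal family spans, since otherwise the
  normalized remainder of a vector outside its span could be added.\<close>

lemma pos_def_form_orthonormal_basis:
  fixes A :: "real ^ 'd ^ 'd"
  assumes "pos_def A"
  obtains B where "finite B" "form_orthonormal A B" "span B = UNIV"
proof -
  let ?P = "\<lambda>B. finite B \<and> form_orthonormal A B"
  have sym: "symmetric_matrix A" and pos: "\<And>v. v \<noteq> 0 \<Longrightarrow> 0 < v \<bullet> (A *v v)"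
    using assms by (auto simp: pos_def_def)
  have "\<exists>B. ?P B \<and> (\<forall>C. ?P C \<longrightarrow> card C \<le> card B)"
  \<comment> \<open>The empty family starts the search; the bound on cardinalities is strict, hence
    the \<open>Suc\<close>.\<close>
  proof (rule ex_has_greatest_nat[where P = ?P and f = card and k = "{}" and b = "Suc DIM(real ^ 'd)"])
    show "?P {}" by (simp add: form_orthonormal_def)
    show "\<forall>C. ?P C \<longrightarrow> card C < Suc DIM(real ^ 'd)"
      using form_orthonormal_independent independent_bound le_imp_less_Suc by blast
  qed
  then obtain B where B: "finite B" "form_orthonormal A B"
    and max: "\<And>C. ?P C \<Longrightarrow> card C \<le> card B" by blast
  have "x \<in> span B" for x
  proof (rule ccontr)
    assume x: "x \<notin> span B"
    \<comment> \<open>The remainder of \<open>x\<close> after its projection with respect to the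
      form; it is nonzero because the projection lies in the span of \<open>B\<close>.\<close>
    define y where "y = x - (\<Sum>b\<in>B. (b \<bullet> (A *v x)) *\<^sub>R b)"
    have "(\<Sum>b\<in>B. (b \<bullet> (A *v x)) *\<^sub>R b) \<in> span B"
      by (intro span_sum span_scale span_base)
    then have "y \<notin> span B"
      using x unfolding y_def by (metis diff_add_cancel span_add)
    then have "y \<noteq> 0" using span_zero by metis
    have orth: "c \<bullet> (A *v y) = 0" if c: "c \<in> B" for c
    proof -
      have "c \<bullet> (A *v y) = c \<bullet> (A *v x) - (\<Sum>b\<in>B. (b \<bullet> (A *v x)) * (c \<bullet> (A *v b)))"
        by (simp add: y_def matrix_vector_mult_diff_distrib inner_diff_right matrix_vector_mult_sum
            inner_sum_right matrix_vector_mult_scaleR)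
      also have "(\<Sum>b\<in>B. (b \<bullet> (A *v x)) * (c \<bullet> (A *v b))) = (\<Sum>b\<in>B. if b = c then b \<bullet> (A *v x) else 0)"
        using B(2) c by (intro sum.cong) (auto simp: form_orthonormal_def)
      finally show ?thesis using B(1) c by simp
    qed
    define z where "z = y /\<^sub>R sqrt (y \<bullet> (A *v y))"
    have ypos: "0 < y \<bullet> (A *v y)" using pos[OF \<open>y \<noteq> 0\<close>] .
    have zz: "z \<bullet> (A *v z) = 1"
      using ypos by (simp add: z_def matrix_vector_mult_scaleR field_simps)
    have cz: "c \<bullet> (A *v z) = 0" if "c \<in> B" for c
      using orth[OF that] by (simp add: z_def matrix_vector_mult_scaleR)
    have zc: "z \<bullet> (A *v c) = 0" if "c \<in> B" for c
      using cz[OF that] symmetric_matrix_inner_commute[OF sym] by metis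
    have "z \<notin> B" using cz zz by force
    moreover have "form_orthonormal A (insert z B)"
      using B(2) zz cz zc by (auto simp: form_orthonormal_def)
    ultimately show False
      using max[of "insert z B"] B(1) by simp
  qed
  then show thesis using that B by blast
qed

text \<open>Both sides are linear in \<open>v\<close> and agree on \<open>B\<close>, which
  spans.\<close>

lemma form_orthonormal_expansion:
  assumes "finite B" "form_orthonormal A B" "span B = UNIV"
  shows "v = (\<Sum>b\<in>B. (b \<bullet> (A *v v)) *\<^sub>R b)"
proof -
  have lin: "linear (\<lambda>v. \<Sum>b\<in>B. (b \<bullet> (A *v v)) *\<^sub>R b)"
    by (intro linear_compose_sum ballI linearI)
      (simp_all add: matrix_vector_right_distrib inner_add_right scaleR_add_left matrix_vector_mult_scaleR)
  have eq: "id x = (\<Sum>b\<in>B. (b \<bullet> (A *v x)) *\<^sub>R b)" if "x \<in> B" for x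
  proof -
    have "(\<Sum>b\<in>B. (b \<bullet> (A *v x)) *\<^sub>R b) = (\<Sum>b\<in>B. if b = x then b else 0)"
      using assms(2) that by (intro sum.cong) (auto simp: form_orthonormal_def)
    then show ?thesis using assms(1) that by simp
  qed
  have "v \<in> span B" using assms(3) by simp
  from linear_eq_on_span[OF linear_id lin eq this] show ?thesis by simp
qed

section \<open>The inverse matrix, its trace pairing and the Loewner order\<close>

text \<open>\<open>matrix_inv\<close> chooses some two-sided inverse. For square matrices a left
  inverse is two-sided, and associativity leaves the choice no freedom.\<close>

lemma matrix_inv_unique_right:
  fixes A P :: "real ^ 'd ^ 'd"
  assumes "P ** A = mat 1"
  shows "matrix_inv A = P"
proof -
  have AP: "A ** P = mat 1" using assms matrix_left_right_inverse by blast
  have "A ** matrix_inv A = mat 1 \<and> matrix_inv A ** A = mat 1"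
    unfolding matrix_inv_def using assms AP by (rule_tac someI[of _ P]) simp
  then show ?thesis
    using assms by (metis matrix_mul_assoc matrix_mul_lid matrix_mul_rid)
qed

text \<open>The expansion of \<open>v\<close> in \<open>B\<close> says that the sum of the rank-one
  matrices of the basis vectors, applied to \<open>A *v v\<close>, returns \<open>v\<close>; so this
  sum is the inverse of \<open>A\<close>.\<close>

lemma trace_matrix_inv_eq_sum:
  fixes A Y :: "real ^ 'd ^ 'd"
  assumes "finite B" "form_orthonormal A B" "span B = UNIV" "symmetric_matrix A"
  shows "trace (Y ** matrix_inv A) = (\<Sum>b\<in>B. b \<bullet> (Y *v b))"
proof -
  define P :: "real ^ 'd ^ 'd" where "P = (\<chi> i j. \<Sum>b\<in>B. b $ i * b $ j)"
  have Pv: "P *v v = (\<Sum>b\<in>B. (b \<bullet> v) *\<^sub>R b)" for v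
    by (simp add: P_def matrix_vector_mult_def vec_eq_iff inner_vec_def sum_distrib_right
        sum_distrib_left mult_ac) (subst sum.swap, simp add: mult_ac)
  have "(P ** A) *v v = mat 1 *v v" for v
    using form_orthonormal_expansion[OF assms(1-3), of v]
    by (simp add: matrix_vector_mul_assoc[symmetric] Pv)
  then have "P ** A = mat 1" by (simp add: matrix_eq)
  then have "matrix_inv A = P" by (rule matrix_inv_unique_right)
  then have "trace (Y ** matrix_inv A) = (\<Sum>i\<in>UNIV. \<Sum>k\<in>UNIV. \<Sum>b\<in>B. Y $ i $ k * (b $ k * b $ i))"
    by (simp add: trace_def matrix_matrix_mult_def P_def sum_distrib_left)
  also have "\<dots> = (\<Sum>i\<in>UNIV. \<Sum>b\<in>B. \<Sum>k\<in>UNIV. Y $ i $ k * (b $ k * b $ i))"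
    by (intro sum.cong refl sum.swap)
  also have "\<dots> = (\<Sum>b\<in>B. \<Sum>i\<in>UNIV. \<Sum>k\<in>UNIV. Y $ i $ k * (b $ k * b $ i))"
    by (rule sum.swap)
  also have "\<dots> = (\<Sum>b\<in>B. b \<bullet> (Y *v b))"
    by (simp add: inner_vec_def matrix_vector_mult_def sum_distrib_left mult_ac)
  finally show ?thesis .
qed

text \<open>A Cauchy-Schwarz inequality: twice the difference of the two sides is a sum over pairs
  \<open>b\<close>, \<open>e\<close> of the form at
  \<open>c b *\<^sub>R e - c e *\<^sub>R b\<close>, and each term is nonnegative.\<close>

lemma pos_semidef_form_le_sum:
  fixes Y :: "real ^ 'd ^ 'd" and c :: "real ^ 'd \<Rightarrow> real" and B :: "(real ^ 'd) set"
  assumes "pos_semidef Y"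
  defines "v \<equiv> (\<Sum>b\<in>B. c b *\<^sub>R b)"
  shows "v \<bullet> (Y *v v) \<le> (\<Sum>b\<in>B. (c b)\<^sup>2) * (\<Sum>b\<in>B. b \<bullet> (Y *v b))"
proof -
  have sym: "symmetric_matrix Y" and pos: "\<And>v. 0 \<le> v \<bullet> (Y *v v)"
    using assms by (auto simp: pos_semidef_def)
  let ?q = "\<lambda>b. b \<bullet> (Y *v b)"
  have expand: "?q (s *\<^sub>R e - t *\<^sub>R b) = s\<^sup>2 * ?q e + t\<^sup>2 * ?q b - 2 * (s * t * (b \<bullet> (Y *v e)))" for s t b e
  proof -
    have "e \<bullet> (Y *v b) = b \<bullet> (Y *v e)"
      by (rule symmetric_matrix_inner_commute[OF sym])
    then have "?q (s *\<^sub>R e - t *\<^sub>R b) = s * (s * ?q e) - s * (t * (b \<bullet> (Y *v e))) - (t * (s * (b \<bullet> (Y *v e))) - t * (t * ?q b))"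
      by (simp add: matrix_vector_mult_diff_distrib matrix_vector_mult_scaleR inner_diff_left
          inner_diff_right right_diff_distrib)
    then show ?thesis by (simp add: power2_eq_square)
  qed
  \<comment> \<open>Lagrange's identity\<close>
  have "0 \<le> (\<Sum>b\<in>B. \<Sum>e\<in>B. ?q (c b *\<^sub>R e - c e *\<^sub>R b))"
    by (intro sum_nonneg pos)
  also have "\<dots> = (\<Sum>b\<in>B. \<Sum>e\<in>B. (c b)\<^sup>2 * ?q e + (c e)\<^sup>2 * ?q b - 2 * (c b * c e * (b \<bullet> (Y *v e))))"
    by (intro sum.cong refl expand)
  also have "\<dots> = 2 * ((\<Sum>b\<in>B. (c b)\<^sup>2) * (\<Sum>b\<in>B. ?q b)) - 2 * (\<Sum>b\<in>B. \<Sum>e\<in>B. c b * c e * (b \<bullet> (Y *v e)))"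
    by (simp add: sum_subtractf sum.distrib sum_distrib_left[symmetric] sum_distrib_right[symmetric])
  also have "(\<Sum>b\<in>B. \<Sum>e\<in>B. c b * c e * (b \<bullet> (Y *v e))) = v \<bullet> (Y *v v)"
    by (simp add: v_def matrix_vector_mult_sum inner_sum_left inner_sum_right
        matrix_vector_mult_scaleR sum_distrib_left mult_ac)
      (intro sum.cong refl, metis sym symmetric_matrix_inner_commute)
  finally show ?thesis by simp
qed

text \<open>In coordinates with respect to \<open>B\<close> the form of \<open>A\<close> is a sum of
  squares and the trace is a sum of forms of \<open>Y\<close>, so the Cauchy-Schwarz bound applies.
  Read contrapositively, a failure of the matrix order forces the trace above
  \<open>u\<close>.\<close>

lemma loewner_le_scaleR_if_trace_le:
  fixes A Y :: "real ^ 'd ^ 'd"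
  assumes A: "pos_def A" and Y: "pos_semidef Y" and tr: "trace (Y ** matrix_inv A) \<le> u"
  shows "Y \<preceq> u *\<^sub>R A"
proof -
  have symA: "symmetric_matrix A" using A by (simp add: pos_def_def)
  obtain B where B: "finite B" "form_orthonormal A B" "span B = UNIV"
    using pos_def_form_orthonormal_basis[OF A] .
  have "v \<bullet> (Y *v v) \<le> u * (v \<bullet> (A *v v))" for v
  proof -
    let ?c = "\<lambda>b. b \<bullet> (A *v v)"
    have v: "(\<Sum>b\<in>B. ?c b *\<^sub>R b) = v"
      using form_orthonormal_expansion[OF B] by simp
    have "v \<bullet> (A *v v) = (\<Sum>b\<in>B. ?c b *\<^sub>R b) \<bullet> (A *v v)"
      by (simp add: v)
    also have "\<dots> = (\<Sum>b\<in>B. (?c b)\<^sup>2)"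
      by (simp add: inner_sum_left power2_eq_square)
    finally have c2: "v \<bullet> (A *v v) = (\<Sum>b\<in>B. (?c b)\<^sup>2)" .
    have "v \<bullet> (Y *v v) \<le> (v \<bullet> (A *v v)) * (\<Sum>b\<in>B. b \<bullet> (Y *v b))"
      using pos_semidef_form_le_sum[OF Y, of ?c B] by (simp add: v c2)
    also have "\<dots> \<le> (v \<bullet> (A *v v)) * u"
      using tr by (intro mult_left_mono) (simp_all add: trace_matrix_inv_eq_sum[OF B symA] c2 sum_nonneg)
    finally show ?thesis by (simp add: mult.commute)
  qed
  moreover have "symmetric_matrix (u *\<^sub>R A - Y)"
    using symA Y by (auto simp: pos_semidef_def symmetric_matrix_def transpose_def vec_eq_iff)
  ultimately show ?thesis
    by (simp add: loewner_le_def pos_semidef_def matrix_vector_mult_diff_rdistrib inner_diff_right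
        scaleR_matrix_vector_assoc[symmetric])
qed

section \<open>Nonnegative scalar supermartingales\<close>

text \<open>Buy low, sell high: a position is opened below \<open>a\<close> and closed above
  \<open>b\<close>. The value at \<open>n\<close> governs the step from \<open>n\<close> to
  \<open>Suc n\<close>, so an upcrossing is completed at \<open>Suc n\<close> exactly if
  \<open>holding a b x n\<close> and \<open>b < x (Suc n)\<close>.\<close>

primrec holding :: "real \<Rightarrow> real \<Rightarrow> (nat \<Rightarrow> real) \<Rightarrow> nat \<Rightarrow> bool" where
  "holding a b x 0 \<longleftrightarrow> x 0 < a"
| "holding a b x (Suc n) \<longleftrightarrow> (if holding a b x n then x (Suc n) \<le> b else x (Suc n) < a)"

text \<open>After the last completed upcrossing, either some position is open and then never closes,
  or none is ever opened.\<close>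

lemma eventually_one_side_if_finitely_many_upcrossings:
  assumes "\<forall>\<^sub>F n in sequentially. \<not> (holding a b x n \<and> b < x (Suc n))"
  shows "(\<forall>\<^sub>F n in sequentially. x n \<le> b) \<or> (\<forall>\<^sub>F n in sequentially. a \<le> x n)"
proof -
  obtain N where N: "\<And>n. N \<le> n \<Longrightarrow> holding a b x n \<Longrightarrow> x (Suc n) \<le> b"
    using assms by (auto simp: eventually_sequentially not_less)
  show ?thesis
  proof (cases "\<exists>m\<ge>N. holding a b x m")
    case True
    then obtain m where m: "N \<le> m" "holding a b x m" by blast
    have "holding a b x n" if "m \<le> n" for n
      using that by (induction n rule: dec_induct) (use m N in auto)
    then have "x n \<le> b" if "Suc m \<le> n" for n
      using that N m(1) by (cases n) auto
    then show ?thesis unfolding eventually_sequentially by blast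
  next
    case False
    then have "a \<le> x (Suc n)" if "N \<le> n" for n
      using that by (metis holding.simps(2) not_less le_SucI)
    then have "a \<le> x n" if "Suc N \<le> n" for n
      using that by (cases n) auto
    then show ?thesis unfolding eventually_sequentially by blast
  qed
qed

text \<open>The limit is the finite liminf \<open>l\<close>. For rational levels
  \<open>l < a < b < c\<close>, staying above \<open>a\<close> would raise the liminf to at least
  \<open>a\<close>; hence the sequence finally stays below \<open>b\<close>.\<close>

lemma convergent_if_finitely_many_upcrossings:
  fixes x :: "nat \<Rightarrow> real"
  assumes nonneg: "\<And>n. 0 \<le> x n"
    and fin: "liminf (\<lambda>n. ennreal (x n)) \<noteq> \<infinity>"
    and cross: "\<And>a b. a \<in> \<rat> \<Longrightarrow> b \<in> \<rat> \<Longrightarrow> a < b \<Longrightarrow>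
      \<forall>\<^sub>F n in sequentially. \<not> (holding a b x n \<and> b < x (Suc n))"
  shows "convergent x"
proof -
  obtain l where l: "0 \<le> l" "liminf (\<lambda>n. ennreal (x n)) = ennreal l"
    using fin by (cases "liminf (\<lambda>n. ennreal (x n))") auto
  have "x \<longlonglongrightarrow> l"
  proof (rule order_tendstoI)
    fix c assume "c < l"
    show "\<forall>\<^sub>F n in sequentially. c < x n"
    proof (cases "0 \<le> c")
      case True
      then have "ennreal c < liminf (\<lambda>n. ennreal (x n))"
        using \<open>c < l\<close> l by (simp add: ennreal_lessI)
      then have "\<forall>\<^sub>F n in sequentially. ennreal c < ennreal (x n)"
        by (rule less_LiminfD)
      then show ?thesis
        by eventually_elim (use True in \<open>simp add: ennreal_less_iff\<close>)
    qed (use nonneg in \<open>auto intro!: always_eventually intro: less_le_trans simp: not_le\<close>)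
  next
    fix c assume "l < c"
    obtain a where a: "a \<in> \<rat>" "l < a" "a < c" using Rats_dense_in_real[OF \<open>l < c\<close>] by blast
    obtain b where b: "b \<in> \<rat>" "a < b" "b < c" using Rats_dense_in_real[OF \<open>a < c\<close>] by blast
    have "\<not> (\<forall>\<^sub>F n in sequentially. a \<le> x n)"
    proof
      assume "\<forall>\<^sub>F n in sequentially. a \<le> x n"
      then have "\<forall>\<^sub>F n in sequentially. ennreal a \<le> ennreal (x n)"
        by eventually_elim (rule ennreal_leI)
      then have "ennreal a \<le> liminf (\<lambda>n. ennreal (x n))"
        by (rule Liminf_bounded)
      then have "ennreal a \<le> ennreal l"
        by (simp only: l(2))
      then show False using a(2) l(1) by (simp add: ennreal_le_iff)
    qed
    then have "\<forall>\<^sub>F n in sequentially. x n \<le> b"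
      using eventually_one_side_if_finitely_many_upcrossings cross a(1) b(1,2) by blast
    then show "\<forall>\<^sub>F n in sequentially. x n < c"
      by eventually_elim (use b(3) in simp)
  qed
  then show ?thesis by (rule convergentI)
qed

text \<open>\<open>g n\<close> decides whether the step from \<open>n\<close> to
  \<open>Suc n\<close> is taken. For antitone \<open>g\<close> the sequence is frozen at the value
  of \<open>x\<close> at the first index where \<open>g\<close> fails.\<close>

primrec stop_at :: "(nat \<Rightarrow> bool) \<Rightarrow> (nat \<Rightarrow> real) \<Rightarrow> nat \<Rightarrow> real" where
  "stop_at g x 0 = x 0"
| "stop_at g x (Suc n) = (if g n then x (Suc n) else stop_at g x n)"

lemma stop_at_eq:
  "\<forall>i<m. g i \<Longrightarrow> stop_at g x m = x m"
  by (cases m) auto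

lemma stop_at_constant:
  assumes "antimono g" "\<not> g m" "m \<le> n"
  shows "stop_at g x n = stop_at g x m"
  using assms(3)
proof (induction n rule: dec_induct)
  case (step n)
  then have "\<not> g n" using antimonoD[OF assms(1), of m n] assms(2) by auto
  then show ?case using step by simp
qed simp

section \<open>Upcrossings and convergence of a nonnegative supermartingale\<close>

text \<open>The supermartingale property is stated in integrated form, which is what betting on an
  increment with an indicator from \<open>F n\<close> calls for.\<close>

locale nonneg_supermartingale = prob_space M for M :: "'a measure" +
  fixes F :: "nat \<Rightarrow> 'a measure" and X :: "nat \<Rightarrow> 'a \<Rightarrow> real"
  assumes subalg: "subalgebra M (F n)"
    and mono: "m \<le> n \<Longrightarrow> sets (F m) \<subseteq> sets (F n)"
    and adapted: "X n \<in> borel_measurable (F n)"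
    and integrable: "integrable M (X n)"
    and nonneg: "\<omega> \<in> space M \<Longrightarrow> 0 \<le> X n \<omega>"
    and decreasing: "D \<in> sets (F n) \<Longrightarrow>
      (\<integral>\<omega>. indicator D \<omega> * X (Suc n) \<omega> \<partial>M) \<le> (\<integral>\<omega>. indicator D \<omega> * X n \<omega> \<partial>M)"
begin

lemma space_F: "space (F n) = space M"
  using subalg by (simp add: subalgebra_def)

lemma measurable_F_mono: "m \<le> n \<Longrightarrow> f \<in> measurable (F m) N \<Longrightarrow> f \<in> measurable (F n) N"
  by (rule subsetD[OF measurable_mono]) (simp_all add: mono space_F)

lemma measurable_F: "f \<in> measurable (F n) N \<Longrightarrow> f \<in> measurable M N"
  using measurable_from_subalg[OF subalg] by blast

lemma measurable_F_infinity: "f \<in> measurable (F n) N \<Longrightarrow> f \<in> measurable (F_infinity M F) N"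
proof (erule measurable_mono[THEN subsetD, rotated -1])
  have sub: "(\<Union>n. sets (F n)) \<subseteq> Pow (space M)"
    using sets.sets_into_space space_F by fastforce
  then show "sets (F n) \<subseteq> sets (F_infinity M F)"
    by (auto simp: F_infinity_def)
  show "space (F n) = space (F_infinity M F)"
    using sub by (simp add: F_infinity_def space_F space_measure_of)
qed simp_all

lemma sets_F_M: "D \<in> sets (F n) \<Longrightarrow> D \<in> sets M"
  using subalg by (auto simp: subalgebra_def)

lemma integrable_increment:
  "D \<in> sets (F n) \<Longrightarrow> integrable M (\<lambda>\<omega>. indicator D \<omega> * (X (Suc n) \<omega> - X n \<omega>))"
  using integrable sets_F_M by (intro integrable_real_mult_indicator[of D M, simplified mult.commute[of _ "indicator D _"]]) auto

lemma integral_increment: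
  assumes "D \<in> sets (F n)"
  shows "(\<integral>\<omega>. indicator D \<omega> * (X (Suc n) \<omega> - X n \<omega>) \<partial>M) \<le> 0"
proof -
  have "integrable M (\<lambda>\<omega>. indicator D \<omega> * X k \<omega>)" for k
    using integrable_real_mult_indicator[OF sets_F_M[OF assms] integrable] by (simp add: mult.commute)
  then show ?thesis
    using decreasing[OF assms] by (simp add: right_diff_distrib)
qed

text \<open>The decision for the step from \<open>n\<close> to \<open>Suc n\<close> is known at time
  \<open>n\<close>, so the expected gain of that step is not positive.\<close>

lemma holding_measurable: "Measurable.pred (F n) (\<lambda>\<omega>. holding a b (\<lambda>k. X k \<omega>) n)"
proof (induction n)
  case 0
  show ?case using adapted[of 0] by simp
next
  case (Suc n)
  have [measurable]: "Measurable.pred (F (Suc n)) (\<lambda>\<omega>. holding a b (\<lambda>k. X k \<omega>) n)"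
    by (rule measurable_F_mono[OF _ Suc]) simp
  note adapted[of "Suc n", measurable]
  show ?case by simp
qed

text \<open>Doob's argument: the strategy earns at least \<open>b - a\<close> per upcrossing and the
  open position costs at most \<open>a\<close>, while the expected gain is not positive. Thus the
  upcrossing probabilities are summable, and Borel-Cantelli applies.\<close>

lemma AE_finitely_many_upcrossings:
  assumes "a < b"
  shows "AE \<omega> in M. \<forall>\<^sub>F n in sequentially. \<not> (holding a b (\<lambda>k. X k \<omega>) n \<and> b < X (Suc n) \<omega>)"
proof (cases "0 < a")
  \<comment> \<open>A nonnegative process never falls below \<open>a \<le> 0\<close>, so no position
    is opened.\<close>
  case False
  have "\<not> holding a b (\<lambda>k. X k \<omega>) n" if "\<omega> \<in> space M" for \<omega> n
    by (induction n) (use False nonneg[OF that] in \<open>auto simp: not_less intro: order_trans[rotated]\<close>)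
  then show ?thesis by (intro AE_I2) auto
next
  case True
  let ?h = "\<lambda>n \<omega>. holding a b (\<lambda>k. X k \<omega>) n"
  define H where "H n = {\<omega> \<in> space M. ?h n \<omega>}" for n
  define G where "G n = {\<omega> \<in> space M. ?h n \<omega> \<and> b < X (Suc n) \<omega>}" for n
  \<comment> \<open>Each upcrossing yields at least \<open>b - a\<close>; \<open>Z\<close> is the position still open, worth at least \<open>- a\<close>.\<close>
  define Z where "Z n \<omega> = indicator (H n) \<omega> * (X n \<omega> - a)" for n \<omega>
  have H: "H n \<in> sets (F n)" for n
    using holding_measurable[of a b n] by (simp add: H_def pred_def space_F)
  have [measurable]: "X n \<in> borel_measurable M" "Measurable.pred M (?h n)" for n
    using measurable_F[OF adapted] measurable_F[OF holding_measurable] by auto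
  have G: "G n \<in> sets M" for n
    unfolding G_def by measurable
  have Zint: "integrable M (Z n)" for n
  proof -
    have "integrable M (\<lambda>\<omega>. X n \<omega> - a)" using integrable by simp
    from integrable_real_mult_indicator[OF sets_F_M[OF H] this] show ?thesis
      by (simp add: Z_def[abs_def] mult.commute)
  qed
  \<comment> \<open>Closing a position earns more than \<open>b - a\<close> and leaves
    \<open>Z\<close> at 0; keeping it gives equality; a newly opened one has negative value.\<close>
  have step: "Z (Suc n) \<omega> + (b - a) * indicator (G n) \<omega>
      \<le> Z n \<omega> + indicator (H n) \<omega> * (X (Suc n) \<omega> - X n \<omega>)" if "\<omega> \<in> space M" for n \<omega>
    using that assms by (auto simp: Z_def H_def G_def indicator_def)
  have "(\<Sum>i<n. (b - a) * prob (G i)) + (\<integral>\<omega>. Z n \<omega> \<partial>M) \<le> 0" for n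
  proof (induction n)
    case 0
    have "(\<integral>\<omega>. Z 0 \<omega> \<partial>M) \<le> (\<integral>\<omega>. 0 \<partial>M)"
      by (intro integral_mono_AE Zint AE_I2) (auto simp: Z_def H_def indicator_def)
    then show ?case by simp
  next
    case (Suc n)
    have "(\<integral>\<omega>. Z (Suc n) \<omega> + (b - a) * indicator (G n) \<omega> \<partial>M)
        \<le> (\<integral>\<omega>. Z n \<omega> + indicator (H n) \<omega> * (X (Suc n) \<omega> - X n \<omega>) \<partial>M)"
      using G by (intro integral_mono_AE AE_I2 step) (auto intro!: Zint integrable_increment H Bochner_Integration.integrable_add
          simp: less_top[symmetric])
    moreover have "(\<integral>\<omega>. Z (Suc n) \<omega> + (b - a) * indicator (G n) \<omega> \<partial>M)
        = (\<integral>\<omega>. Z (Suc n) \<omega> \<partial>M) + (b - a) * prob (G n)"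
      using G by (subst Bochner_Integration.integral_add) (auto simp: Zint less_top[symmetric])
    moreover have "(\<integral>\<omega>. Z n \<omega> + indicator (H n) \<omega> * (X (Suc n) \<omega> - X n \<omega>) \<partial>M)
        = (\<integral>\<omega>. Z n \<omega> \<partial>M) + (\<integral>\<omega>. indicator (H n) \<omega> * (X (Suc n) \<omega> - X n \<omega>) \<partial>M)"
      by (rule Bochner_Integration.integral_add[OF Zint integrable_increment[OF H]])
    ultimately show ?case
      using Suc integral_increment[OF H[of n]] by simp
  qed
  moreover have "- a \<le> (\<integral>\<omega>. Z n \<omega> \<partial>M)" for n
  proof -
    have "(\<integral>\<omega>. - a \<partial>M) \<le> (\<integral>\<omega>. Z n \<omega> \<partial>M)"
      using True nonneg by (intro integral_mono_AE Zint AE_I2) (auto simp: Z_def indicator_def)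
    then show ?thesis by (simp add: prob_space)
  qed
  ultimately have "(\<Sum>i<n. (b - a) * prob (G i)) \<le> a" for n
    by (smt (verit))
  from this[of "Suc _"] have "summable (\<lambda>i. (b - a) * prob (G i))"
    unfolding lessThan_Suc_atMost using assms by (intro bounded_imp_summable[where B = a]) auto
  then have "summable (\<lambda>i. prob (G i))"
    using assms by (simp add: summable_cmult_iff)
  then have "AE \<omega> in M. \<forall>\<^sub>F n in sequentially. \<omega> \<in> space M - G n"
    using G by (intro borel_cantelli_AE1) (auto simp: less_top[symmetric])
  then show ?thesis
    by eventually_elim (auto elim!: eventually_mono simp: G_def)
qed

lemma integral_le_initial: "(\<integral>\<omega>. X n \<omega> \<partial>M) \<le> (\<integral>\<omega>. X 0 \<omega> \<partial>M)"
proof (induction n)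
  case (Suc n)
  have "space M \<in> sets (F n)" using space_F[of n] sets.top by metis
  from integral_increment[OF this] have "(\<integral>\<omega>. X (Suc n) \<omega> - X n \<omega> \<partial>M) \<le> 0"
    by (simp cong: Bochner_Integration.integral_cong)
  then show ?case using Suc integrable by simp
qed simp

text \<open>Fatou's lemma makes the liminf finite almost surely, and the rational pairs of levels
  form a countable set.\<close>

lemma AE_convergent: "AE \<omega> in M. convergent (\<lambda>n. X n \<omega>)"
proof -
  have [measurable]: "X n \<in> borel_measurable M" for n
    using measurable_F[OF adapted] .
  have "(\<integral>\<^sup>+\<omega>. liminf (\<lambda>n. ennreal (X n \<omega>)) \<partial>M) \<le> liminf (\<lambda>n. \<integral>\<^sup>+\<omega>. ennreal (X n \<omega>) \<partial>M)"
    by (rule nn_integral_liminf) simp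
  also have "\<dots> \<le> liminf (\<lambda>n. ennreal (\<integral>\<omega>. X 0 \<omega> \<partial>M))"
    using nonneg by (intro Liminf_mono always_eventually allI)
      (simp add: nn_integral_eq_integral[OF integrable] integral_le_initial ennreal_leI)
  also have "\<dots> < \<infinity>" by (simp add: Liminf_const)
  finally have "AE \<omega> in M. liminf (\<lambda>n. ennreal (X n \<omega>)) \<noteq> \<infinity>"
    by (intro nn_integral_noteq_infinite) auto
  moreover have "AE \<omega> in M. \<forall>a\<in>\<rat>. \<forall>b\<in>\<rat>. a < b \<longrightarrow>
      (\<forall>\<^sub>F n in sequentially. \<not> (holding a b (\<lambda>k. X k \<omega>) n \<and> b < X (Suc n) \<omega>))"
    using AE_finitely_many_upcrossings by (simp add: AE_ball_countable[OF countable_rat] )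
  moreover have "AE \<omega> in M. \<omega> \<in> space M" by simp
  ultimately show ?thesis
  proof eventually_elim
    case (elim \<omega>)
    show ?case
      by (rule convergent_if_finitely_many_upcrossings) (use elim nonneg in auto)
  qed
qed

end

section \<open>Randomized optional stopping\<close>

text \<open>Preimages under \<open>V\<close> lie in \<open>G\<close>, so they are independent of
  those under \<open>U\<close>. Both families are stable under intersection, so independence extends
  to the generated sigma-algebras.\<close>

lemma (in prob_space) indep_var_of_algebra:
  assumes U: "U \<in> borel_measurable M" and V: "V \<in> borel_measurable G"
    and space: "space G = space M" and indep: "indep_of_algebra M U G"
  shows "indep_var borel V borel U"
proof -
  have ind: "indep_set {U -` B \<inter> space M | B. B \<in> sets borel} (sets G)"
    using indep by (simp add: indep_of_algebra_def)
  then have "sets G \<subseteq> events" by (simp add: indep_sets2_eq)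
  then have V': "V \<in> borel_measurable M"
    using V space by (auto intro: subsetD[OF measurable_mono])
  have V_sets: "V -` B \<inter> space M \<in> sets G" if "B \<in> sets borel" for B
    using measurable_sets[OF V that] space by simp
  have "indep_set {V -` B \<inter> space M | B. B \<in> sets borel} {U -` B \<inter> space M | B. B \<in> sets borel}"
  proof (rule indep_setI)
    fix a b assume "a \<in> {V -` B \<inter> space M | B. B \<in> sets borel}" "b \<in> {U -` B \<inter> space M | B. B \<in> sets borel}"
    then have "prob (b \<inter> a) = prob b * prob a"
      using V_sets by (intro indep_setD[OF ind]) auto
    then show "prob (a \<inter> b) = prob a * prob b"
      by (simp only: Int_commute mult.commute)
  qed (use U V' in \<open>auto intro: measurable_sets\<close>)
  moreover have "Int_stable {f -` B \<inter> space M | B. B \<in> sets borel}" for f :: "'a \<Rightarrow> real"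
    using sets.Int_stable[of "vimage_algebra (space M) f borel"] by (simp add: sets_vimage_algebra2)
  ultimately have "indep_set
      (sigma_sets (space M) {V -` B \<inter> space M | B. B \<in> sets borel})
      (sigma_sets (space M) {U -` B \<inter> space M | B. B \<in> sets borel})"
    by (blast intro: indep_set_sigma_sets)
  then show ?thesis
    using U V' by (simp add: indep_var_eq)
qed

text \<open>
  The clause \<open>V \<omega> = 1\<close> lets the truncated variable cover crossings of the level 1, however
  large \<open>U\<close> is.
\<close>

lemma (in prob_space) super_uniform_le_expectation:
  assumes U: "super_uniform M U" and ind: "indep_var borel V borel U"
    and V01: "\<And>\<omega>. \<omega> \<in> space M \<Longrightarrow> 0 \<le> V \<omega> \<and> V \<omega> \<le> 1"
  shows "emeasure M {\<omega> \<in> space M. U \<omega> \<le> V \<omega> \<or> V \<omega> = 1} \<le> (\<integral>\<^sup>+\<omega>. ennreal (V \<omega>) \<partial>M)"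
proof -
  have [measurable]: "V \<in> borel_measurable M" "U \<in> borel_measurable M"
    using ind by (blast dest: indep_var_rv1 indep_var_rv2)+
  interpret U: prob_space "distr M borel U" by (rule prob_space_distr) simp
  \<comment> \<open>The event becomes a region of the plane. By independence its probability is an
    integral of sections: the section at \<open>v\<close> is \<open>{.. v}\<close>, or the whole
    line if \<open>v = 1\<close>.\<close>
  define S where "S = {p :: real \<times> real. snd p \<le> fst p \<or> fst p = 1}"
  have S[measurable]: "S \<in> sets (borel \<Otimes>\<^sub>M borel)"
  proof -
    have "{p \<in> space (borel \<Otimes>\<^sub>M borel). snd p \<le> fst p \<or> fst p = (1::real)} \<in> sets (borel \<Otimes>\<^sub>M borel)"
      by measurable
    then show ?thesis by (simp add: S_def space_pair_measure)
  qed
  have "emeasure M {\<omega> \<in> space M. U \<omega> \<le> V \<omega> \<or> V \<omega> = 1}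
      = emeasure (distr M (borel \<Otimes>\<^sub>M borel) (\<lambda>\<omega>. (V \<omega>, U \<omega>))) S"
    by (subst emeasure_distr[OF _ S]) (auto simp: S_def intro!: arg_cong[where f = "emeasure M"])
  also have "\<dots> = emeasure (distr M borel V \<Otimes>\<^sub>M distr M borel U) S"
    using ind by (simp add: indep_var_distribution_eq)
  also have "\<dots> = (\<integral>\<^sup>+v. emeasure (distr M borel U) (Pair v -` S) \<partial>distr M borel V)"
    by (rule U.emeasure_pair_measure_alt) (simp cong: sets_pair_measure_cong)
  also have "\<dots> = (\<integral>\<^sup>+\<omega>. emeasure (distr M borel U) (Pair (V \<omega>) -` S) \<partial>M)"
  proof (rule nn_integral_distr)
    show "(\<lambda>v. emeasure (distr M borel U) (Pair v -` S)) \<in> borel_measurable (distr M borel V)"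
      by (rule U.measurable_emeasure_Pair) (simp cong: sets_pair_measure_cong)
  qed simp
  also have "\<dots> \<le> (\<integral>\<^sup>+\<omega>. ennreal (V \<omega>) \<partial>M)"
  proof (rule nn_integral_mono)
    fix \<omega> assume \<omega>: "\<omega> \<in> space M"
    show "emeasure (distr M borel U) (Pair (V \<omega>) -` S) \<le> ennreal (V \<omega>)"
    proof (cases "V \<omega> = 1")
      case True
      then show ?thesis using U.measure_le_1 by simp
    next
      case False
      then have "emeasure (distr M borel U) (Pair (V \<omega>) -` S) = emeasure (distr M borel U) {.. V \<omega>}"
        by (auto simp: S_def intro!: arg_cong[where f = "emeasure (distr M borel U)"])
      also have "\<dots> = ennreal (prob {\<omega>' \<in> space M. U \<omega>' \<le> V \<omega>})"
        by (subst emeasure_distr) (auto simp: emeasure_eq_measure intro!: arg_cong[where f = prob])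
      also have "\<dots> \<le> ennreal (V \<omega>)"
        using U V01[OF \<omega>] by (intro ennreal_leI) (simp add: super_uniform_def)
      finally show ?thesis .
    qed
  qed
  finally show ?thesis .
qed

section \<open>The stopped process and a set covering the bad outcomes\<close>

context nonneg_supermartingale
begin

text \<open>Each step of \<open>Z\<close> is the increment of \<open>X\<close> times the indicator
  of a set in \<open>F n\<close>. Antitonicity ensures that \<open>Z\<close> still agrees with
  \<open>X\<close> while \<open>g\<close> holds.\<close>

lemma stop_at_supermartingale:
  assumes g: "\<And>n. Measurable.pred (F n) (g n)"
    and anti: "\<And>\<omega>. antimono (\<lambda>n. g n \<omega>)"
  defines "Z \<equiv> \<lambda>n \<omega>. stop_at (\<lambda>i. g i \<omega>) (\<lambda>k. X k \<omega>) n"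
  shows "Z n \<in> borel_measurable (F n)"
    and "integrable M (Z n)"
    and "(\<integral>\<omega>. Z n \<omega> \<partial>M) \<le> (\<integral>\<omega>. X 0 \<omega> \<partial>M)"
    and "\<omega> \<in> space M \<Longrightarrow> 0 \<le> Z n \<omega>"
proof -
  define D where "D n = {\<omega> \<in> space M. g n \<omega>}" for n
  have D: "D n \<in> sets (F n)" for n
    using g[of n] by (simp add: D_def pred_def space_F)
  have step: "Z (Suc n) \<omega> = Z n \<omega> + indicator (D n) \<omega> * (X (Suc n) \<omega> - X n \<omega>)"
    if "\<omega> \<in> space M" for n \<omega>
  proof (cases "g n \<omega>")
    case True
    then have "\<forall>i<n. g i \<omega>"
      using antimonoD[OF anti, of _ n \<omega>] by (auto simp: less_imp_le)
    then show ?thesis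
      using True that by (simp add: Z_def D_def stop_at_eq)
  qed (simp add: Z_def D_def)
  have Z_Suc: "(Z (Suc n) \<in> borel_measurable N) \<longleftrightarrow> (\<lambda>\<omega>. Z n \<omega> + indicator (D n) \<omega> * (X (Suc n) \<omega> - X n \<omega>)) \<in> borel_measurable N"
    if "space N = space M" for n and N :: "'a measure"
    using step that by (intro measurable_cong) simp
  show "Z n \<in> borel_measurable (F n)" for n
  proof (induction n)
    case 0
    show ?case using adapted[of 0] by (simp add: Z_def)
  next
    case (Suc n)
    have [measurable]: "Z n \<in> borel_measurable (F (Suc n))" "X n \<in> borel_measurable (F (Suc n))"
        "X (Suc n) \<in> borel_measurable (F (Suc n))" "D n \<in> sets (F (Suc n))"
      using measurable_F_mono[OF _ Suc] measurable_F_mono[OF _ adapted[of n]] adapted D mono[of n "Suc n"]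
      by auto
    show ?case by (subst Z_Suc) (simp_all add: space_F)
  qed
  show int: "integrable M (Z n)" for n
  proof (induction n)
    case (Suc n)
    then show ?case
      using step integrable_increment[OF D]
      by (subst Bochner_Integration.integrable_cong[OF refl step]) auto
  qed (simp add: Z_def integrable)
  show "(\<integral>\<omega>. Z n \<omega> \<partial>M) \<le> (\<integral>\<omega>. X 0 \<omega> \<partial>M)" for n
  proof (induction n)
    case (Suc n)
    have "(\<integral>\<omega>. Z (Suc n) \<omega> \<partial>M) = (\<integral>\<omega>. Z n \<omega> + indicator (D n) \<omega> * (X (Suc n) \<omega> - X n \<omega>) \<partial>M)"
      by (rule Bochner_Integration.integral_cong[OF refl step])
    also have "\<dots> = (\<integral>\<omega>. Z n \<omega> \<partial>M) + (\<integral>\<omega>. indicator (D n) \<omega> * (X (Suc n) \<omega> - X n \<omega>) \<partial>M)"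
      by (rule Bochner_Integration.integral_add[OF int integrable_increment[OF D]])
    finally show ?case using Suc integral_increment[OF D[of n]] by simp
  qed (simp add: Z_def)
  show "0 \<le> Z n \<omega>" if "\<omega> \<in> space M" for n \<omega>
    by (induction n) (simp_all add: Z_def nonneg[OF that])
qed

text \<open>The conclusion offers one measurable \<open>E\<close> that contains every bad outcome.
  It is built from the value of \<open>X\<close> stopped at \<open>\<tau>\<close> or at the first
  passage above 1.\<close>

lemma randomized_optional_stopping:
  assumes \<tau>: "enat_stopping_time F \<tau>" and U: "super_uniform M U"
    and indep: "indep_of_algebra M U (F_infinity M F)"
  obtains E where "E \<in> events" "prob E \<le> (\<integral>\<omega>. X 0 \<omega> \<partial>M)"
    "\<And>\<omega> n. \<omega> \<in> space M \<Longrightarrow> enat n < \<tau> \<omega> \<Longrightarrow> 1 < X n \<omega> \<Longrightarrow> \<omega> \<in> E"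
    "\<And>\<omega> n. \<omega> \<in> space M \<Longrightarrow> \<tau> \<omega> = enat n \<Longrightarrow> U \<omega> \<le> X n \<omega> \<Longrightarrow> \<omega> \<in> E"
    "\<And>\<omega> L. \<omega> \<in> space M \<Longrightarrow> \<tau> \<omega> = \<infinity> \<Longrightarrow> (\<lambda>n. X n \<omega>) \<longlonglongrightarrow> L \<Longrightarrow> U \<omega> \<le> L \<Longrightarrow> \<omega> \<in> E"
proof -
  \<comment> \<open>The test at time \<open>n\<close> precedes the step to \<open>Suc n\<close>, so
    the stopped value includes the first one above 1.\<close>
  define g where "g n \<omega> \<longleftrightarrow> enat n < \<tau> \<omega> \<and> (\<forall>i\<le>n. X i \<omega> \<le> 1)" for n \<omega>
  define Z where "Z n \<omega> = stop_at (\<lambda>i. g i \<omega>) (\<lambda>k. X k \<omega>) n" for n \<omega>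
  \<comment> \<open>The liminf is measurable and exists everywhere. Truncating before
    \<open>enn2real\<close> matters, since \<open>enn2real\<close> sends infinity to 0.\<close>
  define V where "V \<omega> = enn2real (min 1 (liminf (\<lambda>n. ennreal (Z n \<omega>))))" for \<omega>
  define E where "E = {\<omega> \<in> space M. U \<omega> \<le> V \<omega> \<or> V \<omega> = 1}"
  have g: "Measurable.pred (F n) (g n)" for n
  proof -
    have [measurable]: "X i \<in> borel_measurable (F n)" if "i \<le> n" for i
      by (rule measurable_F_mono[OF that adapted])
    have \<tau>_le: "Measurable.pred (F n) (\<lambda>\<omega>. \<tau> \<omega> \<le> enat n)"
      using \<tau> by (simp add: enat_stopping_time_def)
    have X_le: "Measurable.pred (F n) (\<lambda>\<omega>. \<forall>i\<in>{..n}. X i \<omega> \<le> 1)"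
      by measurable
    have "Measurable.pred (F n) (\<lambda>\<omega>. \<not> \<tau> \<omega> \<le> enat n \<and> (\<forall>i\<in>{..n}. X i \<omega> \<le> 1))"
      by (intro pred_intros_logic \<tau>_le X_le)
    then show ?thesis by (simp add: g_def[abs_def] not_le Ball_def)
  qed
  have anti: "antimono (\<lambda>n. g n \<omega>)" for \<omega>
    by (rule antimonoI) (auto simp: g_def intro: le_less_trans[of "enat _" "enat _"])
  note Z = stop_at_supermartingale[of g, OF g anti, folded Z_def]
  have space_inf: "space (F_infinity M F) = space M"
    by (simp add: F_infinity_def space_measure_of_conv)
  have V_meas: "V \<in> borel_measurable (F_infinity M F)"
  proof -
    have [measurable]: "Z n \<in> borel_measurable (F_infinity M F)" for n
      by (rule measurable_F_infinity[OF Z(1)])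
    show ?thesis unfolding V_def[abs_def] by measurable
  qed
  have V01: "0 \<le> V \<omega> \<and> V \<omega> \<le> 1" for \<omega>
    using enn2real_mono[of "min 1 (liminf (\<lambda>n. ennreal (Z n \<omega>)))" 1] by (simp add: V_def)
  have ind: "indep_var borel V borel U"
    using U V_meas space_inf indep by (intro indep_var_of_algebra) (simp_all add: super_uniform_def)
  then have [measurable]: "V \<in> borel_measurable M" "U \<in> borel_measurable M"
    by (blast dest: indep_var_rv1 indep_var_rv2)+
  have Z_meas[measurable]: "Z n \<in> borel_measurable M" for n
    by (rule measurable_F[OF Z(1)])
  have "E \<in> events" unfolding E_def by measurable
  have "emeasure M E \<le> (\<integral>\<^sup>+\<omega>. ennreal (V \<omega>) \<partial>M)"
    unfolding E_def by (rule super_uniform_le_expectation[OF U ind V01])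
  also have "\<dots> \<le> (\<integral>\<^sup>+\<omega>. liminf (\<lambda>n. ennreal (Z n \<omega>)) \<partial>M)"
    by (intro nn_integral_mono) (simp add: V_def min_def less_top[symmetric] ennreal_enn2real_if)
  also have "\<dots> \<le> liminf (\<lambda>n. \<integral>\<^sup>+\<omega>. ennreal (Z n \<omega>) \<partial>M)"
    by (rule nn_integral_liminf) simp
  also have "\<dots> \<le> liminf (\<lambda>n. ennreal (\<integral>\<omega>. X 0 \<omega> \<partial>M))"
    using Z(4) by (intro Liminf_mono always_eventually allI)
      (simp add: nn_integral_eq_integral[OF Z(2)] Z(3) ennreal_leI)
  finally have "emeasure M E \<le> ennreal (\<integral>\<omega>. X 0 \<omega> \<partial>M)"
    by (simp add: Liminf_const)
  then have "prob E \<le> (\<integral>\<omega>. X 0 \<omega> \<partial>M)"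
    using nonneg by (subst (asm) emeasure_eq_measure) (simp add: ennreal_le_iff Bochner_Integration.integral_nonneg)
  moreover have V_lim: "V \<omega> = min 1 L" if "\<omega> \<in> space M" "(\<lambda>n. Z n \<omega>) \<longlonglongrightarrow> L" for \<omega> L
  proof -
    have "0 \<le> L" using Z(4)[OF that(1)] that(2) by (intro LIMSEQ_le_const) auto
    have "liminf (\<lambda>n. ennreal (Z n \<omega>)) = ennreal L"
      using that(2) by (intro lim_imp_Liminf tendsto_ennrealI) simp_all
    then show ?thesis
      using \<open>0 \<le> L\<close> by (auto simp: V_def min_def)
  qed
  have V_stop: "V \<omega> = min 1 (X m \<omega>)" if "\<omega> \<in> space M" "\<forall>i<m. g i \<omega>" "\<not> g m \<omega>" for \<omega> m
  proof (rule V_lim[OF that(1)])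
    have "Z n \<omega> = X m \<omega>" if "m \<le> n" for n
      using stop_at_constant[OF anti \<open>\<not> g m \<omega>\<close> that, of "\<lambda>k. X k \<omega>"] stop_at_eq[OF \<open>\<forall>i<m. g i \<omega>\<close>]
      by (simp add: Z_def)
    then show "(\<lambda>n. Z n \<omega>) \<longlonglongrightarrow> X m \<omega>"
      by (intro tendsto_eventually) (auto simp: eventually_sequentially)
  qed
  have crossing: "\<omega> \<in> E" if "\<omega> \<in> space M" "enat n < \<tau> \<omega>" "1 < X n \<omega>" for \<omega> n
  proof -
    \<comment> \<open>The first passage above 1. It comes before \<open>\<tau>\<close>, so
      \<open>Z\<close> freezes there and truncation gives \<open>V \<omega> = 1\<close>.\<close>
    define m where "m = (LEAST m. 1 < X m \<omega>)"
    have m: "1 < X m \<omega>" "m \<le> n"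
      using that(3) unfolding m_def by (rule LeastI, rule Least_le)
    have "X i \<omega> \<le> 1" if "i < m" for i
      using not_less_Least[of i "\<lambda>m. 1 < X m \<omega>"] that by (simp add: m_def)
    moreover have "enat i < \<tau> \<omega>" if "i < m" for i
      using that m(2) \<open>enat n < \<tau> \<omega>\<close> by (intro less_trans[OF _ \<open>enat n < \<tau> \<omega>\<close>]) simp
    ultimately have "\<forall>i<m. g i \<omega>" by (auto simp: g_def)
    moreover have "\<not> g m \<omega>" using m(1) by (force simp: g_def)
    ultimately have "V \<omega> = 1" using V_stop[OF that(1)] m(1) by simp
    then show ?thesis using that(1) by (simp add: E_def)
  qed
  moreover have "\<omega> \<in> E" if "\<omega> \<in> space M" "\<tau> \<omega> = enat n" "U \<omega> \<le> X n \<omega>" for \<omega> n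
  \<comment> \<open>An earlier passage above 1 already puts the outcome into \<open>E\<close>;
    otherwise \<open>Z\<close> freezes exactly at \<open>n\<close>.\<close>
  proof (cases "\<exists>m<n. 1 < X m \<omega>")
    case True
    then show ?thesis using crossing[OF that(1)] that(2) by auto
  next
    case False
    then have "X m \<omega> \<le> 1" if "m < n" for m
      using False that by (metis not_less)
    then have "\<forall>i<n. g i \<omega>" using that(2) by (simp add: g_def)
    moreover have "\<not> g n \<omega>" using that(2) by (simp add: g_def)
    ultimately have "V \<omega> = min 1 (X n \<omega>)" using V_stop[OF that(1)] by blast
    then show ?thesis using that by (auto simp: E_def min_def)
  qed
  moreover have "\<omega> \<in> E"
    if "\<omega> \<in> space M" "\<tau> \<omega> = \<infinity>" "(\<lambda>n. X n \<omega>) \<longlonglongrightarrow> L" "U \<omega> \<le> L" for \<omega> L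
  proof (cases "\<exists>m. 1 < X m \<omega>")
    case True
    then show ?thesis using crossing[OF that(1)] that(2) by auto
  next
    case False
    then have "\<forall>i<n. g i \<omega>" for n using that(2) by (auto simp: g_def not_less)
    then have "Z n \<omega> = X n \<omega>" for n by (simp add: Z_def stop_at_eq)
    then have "V \<omega> = min 1 L" using V_lim[OF that(1)] that(3) by simp
    then show ?thesis using that by (auto simp: E_def min_def)
  qed
  ultimately show thesis using that \<open>E \<in> events\<close> by blast
qed

end

section \<open>Supermartingales of positive semidefinite matrices\<close>

lemma pos_semidef_limit:
  assumes "f \<longlonglongrightarrow> L" "\<And>n. pos_semidef (f n)"
  shows "pos_semidef L"
proof -
  have ij: "(\<lambda>n. f n $ i $ j) \<longlonglongrightarrow> L $ i $ j" for i j
    by (intro tendsto_vec_nth assms(1))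
  have "f n $ i $ j = f n $ j $ i" for n i j
    using assms(2)[of n] by (auto simp: pos_semidef_def symmetric_matrix_def transpose_def vec_eq_iff)
  then have "L $ i $ j = L $ j $ i" for i j
    using LIMSEQ_unique[OF ij[of i j]] ij[of j i] by simp
  moreover have "0 \<le> v \<bullet> (L *v v)" for v
  proof (rule LIMSEQ_le_const)
    show "(\<lambda>n. v \<bullet> (f n *v v)) \<longlonglongrightarrow> v \<bullet> (L *v v)"
      unfolding inner_vec_def matrix_vector_mult_def by (auto intro!: tendsto_intros ij)
    show "\<exists>N. \<forall>n\<ge>N. 0 \<le> v \<bullet> (f n *v v)"
      using assms(2) by (auto simp: pos_semidef_def)
  qed
  ultimately show ?thesis
    by (auto simp: pos_semidef_def symmetric_matrix_def transpose_def vec_eq_iff)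
qed

text \<open>Carries measurability, integrability and limits from matrix entries to forms.\<close>

lemma inner_matrix_vector_mult_eq_sum:
  fixes Y :: "real ^ 'd ^ 'd"
  shows "v \<bullet> (Y *v v) = (\<Sum>i\<in>UNIV. \<Sum>j\<in>UNIV. v $ i * v $ j * Y $ i $ j)"
  by (simp add: inner_vec_def matrix_vector_mult_def sum_distrib_left mult_ac)

text \<open>Finitely many test vectors determine all entries, so almost sure convergence of each
  form yields that of the matrices.\<close>

lemma convergent_if_forms_convergent:
  fixes f :: "nat \<Rightarrow> real ^ 'd ^ 'd"
  assumes sym: "\<And>n. symmetric_matrix (f n)"
    and conv_axis: "\<And>i. convergent (\<lambda>n. axis i 1 \<bullet> (f n *v axis i 1))"
    and conv_sum: "\<And>i j. convergent (\<lambda>n. (axis i 1 + axis j 1) \<bullet> (f n *v (axis i 1 + axis j 1)))"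
  shows "convergent f"
proof -
  \<comment> \<open>polarization\<close>
  have entry: "f n $ i $ j = ((axis i 1 + axis j 1) \<bullet> (f n *v (axis i 1 + axis j 1))
      - axis i 1 \<bullet> (f n *v axis i 1) - axis j 1 \<bullet> (f n *v axis j 1)) / 2" for n i j
  proof -
    have "axis i 1 \<bullet> (f n *v axis j 1) = f n $ i $ j" for i j
      by (simp add: inner_axis' matrix_vector_mult_basis column_def)
    moreover have "f n $ i $ j = f n $ j $ i"
      using sym[of n] by (auto simp: symmetric_matrix_def transpose_def vec_eq_iff)
    ultimately show ?thesis
      by (simp add: matrix_vector_right_distrib inner_add_left inner_add_right)
  qed
  have "convergent (\<lambda>n. f n $ i $ j)" for i j
    unfolding entry divide_inverse
    by (intro convergent_mult convergent_diff convergent_const conv_axis conv_sum)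
  then have "f \<longlonglongrightarrow> (\<chi> i j. lim (\<lambda>n. f n $ i $ j))"
    by (intro vec_tendstoI) (simp add: convergent_LIMSEQ_iff)
  then show ?thesis by (rule convergentI)
qed

locale psd_supermartingale = prob_space M for M :: "'a measure" +
  fixes F :: "nat \<Rightarrow> 'a measure" and Y :: "nat \<Rightarrow> 'a \<Rightarrow> real ^ 'd ^ 'd"
  assumes filtration: "filtration (space M) F"
    and subalg: "subalgebra M (F n)"
    and supermartingale: "matrix_supermartingale M F Y"
    and psd: "\<omega> \<in> space M \<Longrightarrow> pos_semidef (Y n \<omega>)"
begin

lemma entry_measurable: "(\<lambda>\<omega>. Y n \<omega> $ i $ j) \<in> borel_measurable (F n)"
proof -
  have "Y n \<in> borel_measurable (F n)"
    using supermartingale by (simp add: matrix_supermartingale_def)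
  then show ?thesis
    by (rule borel_measurable_continuous_on[rotated]) (intro continuous_intros)
qed

lemma entry_integrable: "integrable M (\<lambda>\<omega>. Y n \<omega> $ i $ j)"
  using supermartingale by (simp add: matrix_supermartingale_def matrix_integrable_def)

text \<open>Forms are linear in the entries, so the entrywise conditional expectation passes through
  them, and the Loewner inequality bounds each form. Singletons \<open>B\<close> serve convergence,
  a basis serves the trace.\<close>

lemma nonneg_supermartingale_form:
  assumes "finite B"
  shows "nonneg_supermartingale M F (\<lambda>n \<omega>. \<Sum>b\<in>B. b \<bullet> (Y n \<omega> *v b))"
proof unfold_locales
  show "subalgebra M (F n)" for n by (rule subalg)
  show "sets (F m) \<subseteq> sets (F n)" if "m \<le> n" for m n
    using filtration that by (simp add: filtration_def)
  show "(\<lambda>\<omega>. \<Sum>b\<in>B. b \<bullet> (Y n \<omega> *v b)) \<in> borel_measurable (F n)" for n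
    unfolding inner_matrix_vector_mult_eq_sum by (intro borel_measurable_sum borel_measurable_times borel_measurable_const entry_measurable)
  show "integrable M (\<lambda>\<omega>. \<Sum>b\<in>B. b \<bullet> (Y n \<omega> *v b))" for n
    unfolding inner_matrix_vector_mult_eq_sum by (intro Bochner_Integration.integrable_sum Bochner_Integration.integrable_mult_right entry_integrable)
  show "0 \<le> (\<Sum>b\<in>B. b \<bullet> (Y n \<omega> *v b))" if "\<omega> \<in> space M" for n \<omega>
    using psd[OF that] by (intro sum_nonneg) (simp add: pos_semidef_def)
  fix D n assume D: "D \<in> sets (F n)"
  have DM: "D \<in> sets M" using D subalg[of n] by (auto simp: subalgebra_def)
  interpret S: finite_measure_subalgebra M "F n"
    by unfold_locales (rule subalg)
  let ?C = "matrix_cond_exp M (F n) (Y (Suc n))"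
  have C: "?C \<omega> $ i $ j = real_cond_exp M (F n) (\<lambda>\<omega>. Y (Suc n) \<omega> $ i $ j) \<omega>" for \<omega> i j
    by (simp add: matrix_cond_exp_def)
  have C_int: "integrable M (\<lambda>\<omega>. ?C \<omega> $ i $ j)" for i j
    unfolding C by (rule S.real_cond_exp_int[OF entry_integrable])
  have ind_int: "integrable M (\<lambda>\<omega>. indicator D \<omega> * f \<omega>)" if "integrable M f" for f :: "'a \<Rightarrow> real"
    using integrable_real_mult_indicator[OF DM that] by (simp add: mult.commute)
  have form_int: "integrable M (\<lambda>\<omega>. \<Sum>b\<in>B. b \<bullet> (W \<omega> *v b))"
    if "\<And>i j. integrable M (\<lambda>\<omega>. W \<omega> $ i $ j)" for W :: "'a \<Rightarrow> real ^ 'd ^ 'd"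
    unfolding inner_matrix_vector_mult_eq_sum by (intro Bochner_Integration.integrable_sum Bochner_Integration.integrable_mult_right that)
  \<comment> \<open>Reduces the integral of the forms over \<open>D\<close> to entry integrals; it
    is applied to both \<open>Y (Suc n)\<close> and its conditional expectation.\<close>
  have split: "(\<integral>\<omega>. indicator D \<omega> * (\<Sum>b\<in>B. b \<bullet> (W \<omega> *v b)) \<partial>M)
      = (\<Sum>b\<in>B. \<Sum>i\<in>UNIV. \<Sum>j\<in>UNIV. b $ i * b $ j * (\<integral>\<omega>. indicator D \<omega> * W \<omega> $ i $ j \<partial>M))"
    if W: "\<And>i j. integrable M (\<lambda>\<omega>. W \<omega> $ i $ j)" for W :: "'a \<Rightarrow> real ^ 'd ^ 'd"
  proof -
    have "(\<integral>\<omega>. indicator D \<omega> * (\<Sum>b\<in>B. b \<bullet> (W \<omega> *v b)) \<partial>M)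
        = (\<integral>\<omega>. (\<Sum>b\<in>B. \<Sum>i\<in>UNIV. \<Sum>j\<in>UNIV. b $ i * b $ j * (indicator D \<omega> * W \<omega> $ i $ j)) \<partial>M)"
      unfolding inner_matrix_vector_mult_eq_sum
      by (simp only: sum_distrib_left mult.left_commute mult.assoc)
    also have "\<dots> = (\<Sum>b\<in>B. \<Sum>i\<in>UNIV. \<Sum>j\<in>UNIV. b $ i * b $ j * (\<integral>\<omega>. indicator D \<omega> * W \<omega> $ i $ j \<partial>M))"
      by (simp add: Bochner_Integration.integral_sum ind_int[OF W])
    finally show ?thesis .
  qed
  have entry: "(\<integral>\<omega>. indicator D \<omega> * Y (Suc n) \<omega> $ i $ j \<partial>M) = (\<integral>\<omega>. indicator D \<omega> * ?C \<omega> $ i $ j \<partial>M)" for i j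
    using S.real_cond_exp_intA[OF entry_integrable[of "Suc n" i j] D]
    unfolding C set_lebesgue_integral_def real_scaleR_def .
  have "AE \<omega> in M. ?C \<omega> \<preceq> Y n \<omega>"
    using supermartingale unfolding matrix_supermartingale_def by (metis diff_Suc_1 le_add1 plus_1_eq_Suc)
  then have le: "AE \<omega> in M. indicator D \<omega> * (\<Sum>b\<in>B. b \<bullet> (?C \<omega> *v b)) \<le> indicator D \<omega> * (\<Sum>b\<in>B. b \<bullet> (Y n \<omega> *v b))"
    by eventually_elim (auto intro!: mult_left_mono sum_mono
        simp: loewner_le_def pos_semidef_def matrix_vector_mult_diff_rdistrib inner_diff_right)
  have "(\<integral>\<omega>. indicator D \<omega> * (\<Sum>b\<in>B. b \<bullet> (Y (Suc n) \<omega> *v b)) \<partial>M)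
      = (\<integral>\<omega>. indicator D \<omega> * (\<Sum>b\<in>B. b \<bullet> (?C \<omega> *v b)) \<partial>M)"
    by (simp only: split[OF entry_integrable] split[OF C_int] entry)
  also have "\<dots> \<le> (\<integral>\<omega>. indicator D \<omega> * (\<Sum>b\<in>B. b \<bullet> (Y n \<omega> *v b)) \<partial>M)"
    by (intro integral_mono_AE ind_int form_int C_int entry_integrable le)
  finally show "(\<integral>\<omega>. indicator D \<omega> * (\<Sum>b\<in>B. b \<bullet> (Y (Suc n) \<omega> *v b)) \<partial>M)
      \<le> (\<integral>\<omega>. indicator D \<omega> * (\<Sum>b\<in>B. b \<bullet> (Y n \<omega> *v b)) \<partial>M)" .
qed

lemma AE_convergent: "AE \<omega> in M. convergent (\<lambda>n. Y n \<omega>)"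
proof -
  have form: "AE \<omega> in M. convergent (\<lambda>n. v \<bullet> (Y n \<omega> *v v))" for v
    using nonneg_supermartingale.AE_convergent[OF nonneg_supermartingale_form[of "{v}"]] by simp
  have "AE \<omega> in M. \<forall>i. convergent (\<lambda>n. axis i 1 \<bullet> (Y n \<omega> *v axis i 1))"
    by (simp add: AE_all_countable form)
  moreover have "AE \<omega> in M. \<forall>i j. convergent (\<lambda>n. (axis i 1 + axis j 1) \<bullet> (Y n \<omega> *v (axis i 1 + axis j 1)))"
    by (simp add: AE_all_countable form)
  moreover have "AE \<omega> in M. \<omega> \<in> space M" by simp
  ultimately show ?thesis
  proof eventually_elim
    case (elim \<omega>)
    show ?case
      by (rule convergent_if_forms_convergent) (use elim psd in \<open>auto simp: pos_semidef_def\<close>)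
  qed
qed

lemma trace_expectation_matrix_inv:
  assumes "finite B" "form_orthonormal A B" "span B = UNIV" "symmetric_matrix A"
  shows "trace (matrix_expectation M (Y n) ** matrix_inv A) = (\<integral>\<omega>. (\<Sum>b\<in>B. b \<bullet> (Y n \<omega> *v b)) \<partial>M)"
proof -
  have "(\<integral>\<omega>. (\<Sum>b\<in>B. b \<bullet> (Y n \<omega> *v b)) \<partial>M)
      = (\<Sum>b\<in>B. \<Sum>i\<in>UNIV. \<Sum>j\<in>UNIV. b $ i * b $ j * (\<integral>\<omega>. Y n \<omega> $ i $ j \<partial>M))"
    unfolding inner_matrix_vector_mult_eq_sum
    by (simp add: Bochner_Integration.integral_sum entry_integrable)
  then show ?thesis
    unfolding trace_matrix_inv_eq_sum[OF assms] inner_matrix_vector_mult_eq_sum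
    by (simp add: matrix_expectation_def)
qed

end

theorem theorem5p5:
  fixes M :: "'a measure"
    and F :: "nat \<Rightarrow> 'a measure"
    and Y :: "nat \<Rightarrow> 'a \<Rightarrow> real ^ 'd ^ 'd"
    and \<tau> :: "'a \<Rightarrow> enat"
    and U :: "'a \<Rightarrow> real"
    and A :: "real ^ 'd ^ 'd"
  assumes "prob_space M"
    and "filtration (space M) F"
    and "\<And>n. subalgebra M (F n)"
    and "matrix_supermartingale M F Y"
    and "\<And>n \<omega>. \<omega> \<in> space M \<Longrightarrow> pos_semidef (Y n \<omega>)"
    and "enat_stopping_time F \<tau>"
    and "super_uniform M U"
    and "indep_of_algebra M U (F_infinity M F)"
    and "pos_def A"
  shows "measure M {\<omega> \<in> space M. \<not> stopped_value Y \<tau> \<omega> \<preceq> U \<omega> *\<^sub>R A}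
           \<le> trace (matrix_expectation M (Y 0) ** matrix_inv A)
       \<and> measure M {\<omega> \<in> space M. (\<exists>n. enat n < \<tau> \<omega> \<and> \<not> Y n \<omega> \<preceq> A)
                        \<or> \<not> stopped_value Y \<tau> \<omega> \<preceq> U \<omega> *\<^sub>R A}
           \<le> trace (matrix_expectation M (Y 0) ** matrix_inv A)"
proof -
  interpret psd_supermartingale M F Y
    using assms(1-5) by (simp add: psd_supermartingale_def psd_supermartingale_axioms_def)
  have symA: "symmetric_matrix A" using assms(9) by (simp add: pos_def_def)
  obtain B where B: "finite B" "form_orthonormal A B" "span B = UNIV"
    using pos_def_form_orthonormal_basis[OF assms(9)] .
  \<comment> \<open>By \<open>tr\<close> below, this is the trace of
    \<open>Y n \<omega> ** matrix_inv A\<close>.\<close>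
  define X where "X n \<omega> = (\<Sum>b\<in>B. b \<bullet> (Y n \<omega> *v b))" for n \<omega>
  interpret X: nonneg_supermartingale M F X
    using nonneg_supermartingale_form[OF B(1)] by (simp add: X_def[abs_def])
  have tr: "trace (W ** matrix_inv A) = (\<Sum>b\<in>B. b \<bullet> (W *v b))" for W
    by (rule trace_matrix_inv_eq_sum[OF B symA])
  have X0: "(\<integral>\<omega>. X 0 \<omega> \<partial>M) = trace (matrix_expectation M (Y 0) ** matrix_inv A)"
    by (simp add: X_def trace_expectation_matrix_inv[OF B symA])
  obtain E where E: "E \<in> events" "prob E \<le> (\<integral>\<omega>. X 0 \<omega> \<partial>M)"
    and before: "\<And>\<omega> n. \<omega> \<in> space M \<Longrightarrow> enat n < \<tau> \<omega> \<Longrightarrow> 1 < X n \<omega> \<Longrightarrow> \<omega> \<in> E"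
    and at: "\<And>\<omega> n. \<omega> \<in> space M \<Longrightarrow> \<tau> \<omega> = enat n \<Longrightarrow> U \<omega> \<le> X n \<omega> \<Longrightarrow> \<omega> \<in> E"
    and never: "\<And>\<omega> L. \<omega> \<in> space M \<Longrightarrow> \<tau> \<omega> = \<infinity> \<Longrightarrow> (\<lambda>n. X n \<omega>) \<longlonglongrightarrow> L \<Longrightarrow> U \<omega> \<le> L \<Longrightarrow> \<omega> \<in> E"
    by (rule X.randomized_optional_stopping[OF assms(6-8)]) blast
  \<comment> \<open>Convergence is assumed here outcome by outcome; the exceptional null set enters
    only in \<open>bad_E\<close>.\<close>
  have in_E: "\<omega> \<in> E" if \<omega>: "\<omega> \<in> space M" and conv: "convergent (\<lambda>n. Y n \<omega>)"
    and bad: "(\<exists>n. enat n < \<tau> \<omega> \<and> \<not> Y n \<omega> \<preceq> A) \<or> \<not> stopped_value Y \<tau> \<omega> \<preceq> U \<omega> *\<^sub>R A" for \<omega>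
    using bad
  proof
    assume "\<exists>n. enat n < \<tau> \<omega> \<and> \<not> Y n \<omega> \<preceq> A"
    then obtain n where n: "enat n < \<tau> \<omega>" "\<not> Y n \<omega> \<preceq> A" by blast
    have "1 < X n \<omega>"
      using loewner_le_scaleR_if_trace_le[OF assms(9) psd[OF \<omega>], of n 1] n(2)
      by (force simp: tr X_def)
    then show ?thesis using before[OF \<omega> n(1)] by simp
  next
    assume stop: "\<not> stopped_value Y \<tau> \<omega> \<preceq> U \<omega> *\<^sub>R A"
    show ?thesis
    proof (cases "\<tau> \<omega>")
      case (enat n)
      then have "U \<omega> < X n \<omega>"
        using loewner_le_scaleR_if_trace_le[OF assms(9) psd[OF \<omega>], of n "U \<omega>"] stop
        by (force simp: tr X_def stopped_value_def)
      then show ?thesis using at[OF \<omega> enat] by simp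
    next
      case infinity
      let ?L = "lim (\<lambda>n. Y n \<omega>)"
      have lim: "(\<lambda>n. Y n \<omega>) \<longlonglongrightarrow> ?L"
        using conv by (simp add: convergent_LIMSEQ_iff)
      \<comment> \<open>The trace is continuous in the entries, so the scalar limit is the trace at
        the matrix limit.\<close>
      have "(\<lambda>n. X n \<omega>) \<longlonglongrightarrow> trace (?L ** matrix_inv A)"
        unfolding X_def tr inner_matrix_vector_mult_eq_sum
        by (intro tendsto_sum tendsto_mult tendsto_const tendsto_vec_nth lim)
      moreover have "pos_semidef ?L"
        using lim psd[OF \<omega>] by (rule pos_semidef_limit)
      then have "U \<omega> < trace (?L ** matrix_inv A)"
        using loewner_le_scaleR_if_trace_le[OF assms(9), of ?L "U \<omega>"] stop infinity
        by (force simp: stopped_value_def)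
      ultimately show ?thesis using never[OF \<omega> infinity] by simp
    qed
  qed
  have "AE \<omega> in M. \<omega> \<in> space M" by simp
  with AE_convergent have bad_E: "AE \<omega> in M. ((\<exists>n. enat n < \<tau> \<omega> \<and> \<not> Y n \<omega> \<preceq> A)
      \<or> \<not> stopped_value Y \<tau> \<omega> \<preceq> U \<omega> *\<^sub>R A) \<longrightarrow> \<omega> \<in> E"
    by eventually_elim (use in_E in blast)
  \<comment> \<open>Inclusion in \<open>E\<close> up to a null set suffices, and measurability is
    asked of \<open>E\<close> alone.\<close>
  have "prob {\<omega> \<in> space M. \<not> stopped_value Y \<tau> \<omega> \<preceq> U \<omega> *\<^sub>R A} \<le> prob E"
    using bad_E by (intro finite_measure_mono_AE[OF _ E(1)]) (auto elim: eventually_mono)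
  moreover have "prob {\<omega> \<in> space M. (\<exists>n. enat n < \<tau> \<omega> \<and> \<not> Y n \<omega> \<preceq> A)
      \<or> \<not> stopped_value Y \<tau> \<omega> \<preceq> U \<omega> *\<^sub>R A} \<le> prob E"
    using bad_E by (intro finite_measure_mono_AE[OF _ E(1)]) (auto elim: eventually_mono)
  ultimately show ?thesis
    using E(2) unfolding X0 by (auto intro: order_trans)
qed

end
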